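(* Let $Y$ be a random variable whose moment generating function $E[e^{tY}]$ exists for $|t|<\delta$ for some $\delta>0$. Let $(Y_j)_{j\ge1}$ be mutually independent copies of $Y$, $S_0=0$, $S_k=Y_1+\cdots+Y_k$. Define ${n\brace k}_Y=\frac{1}{k!}\sum_{l=0}^{k}\binom{k}{l}(-1)^{k-l}E[S_l^n]$ for $0\le k\le n$, and the probabilistic Bell polynomials $\phi^Y_n(y)=\sum_{k=0}^{n}{n\brace k}_Y y^k$. Then for all $n,l\ge0$, $$\phi^Y_{l+n}(y)=\sum_{k=0}^{n}\sum_{m=0}^{l}\binom{l}{m}\frac{y^k}{k!}\sum_{l_1+\cdots+l_k=n}\binom{n}{l_1,\dots,l_k}E\Big[S_k^{l-m}\prod_{i=1}^{k}Y_i^{l_i}\Big]\phi^Y_m(y),$$ where the inner sum runs over $k$-tuples of positive integers $(l_1,\dots,l_k)$ with $l_1+\cdots+l_k=n$.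
   Context: $E$ denotes expectation. For $k=0$ the inner sum over compositions is the empty-tuple sum, equal to $1$ if $n=0$ and $0$ otherwise (empty product equal to $1$). Equivalently, $\sum_{n\ge0}\phi^Y_n(y) t^n/n!=e^{y(E[e^{Yt}]-1)}$. *)

theory Defs
  imports "HOL-Probability.Probability"
begin

text \<open>
  A sequence \<open>Y\<^sub>1, Y\<^sub>2, \<dots>\<close> of random variables on \<open>M\<close> is a function on \<^typ>\<open>nat\<close> whose value
  at \<open>0\<close> is never used. The notions below depend on the sequence only through its law, so for
  independent copies of a random variable they depend only on the distribution of that variable.
\<close>

definition partial_sum :: "(nat \<Rightarrow> 'a \<Rightarrow> real) \<Rightarrow> nat \<Rightarrow> 'a \<Rightarrow> real" where
  "partial_sum Y k \<omega> = (\<Sum>j=1..k. Y j \<omega>)"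

definition prob_stirling :: "'a measure \<Rightarrow> (nat \<Rightarrow> 'a \<Rightarrow> real) \<Rightarrow> nat \<Rightarrow> nat \<Rightarrow> real" where
  "prob_stirling M Y n k =
     1 / fact k * (\<Sum>l=0..k. real (k choose l) * (-1) ^ (k - l) *
       prob_space.expectation M (\<lambda>\<omega>. partial_sum Y l \<omega> ^ n))"

definition prob_bell :: "'a measure \<Rightarrow> (nat \<Rightarrow> 'a \<Rightarrow> real) \<Rightarrow> nat \<Rightarrow> real \<Rightarrow> real" where
  "prob_bell M Y n y = (\<Sum>k=0..n. prob_stirling M Y n k * y ^ k)"

text \<open>
  Compositions of \<open>n\<close> into \<open>k\<close> positive parts. Tuples are extensional functions on \<open>{1..k}\<close>, so
  each tuple is counted once; for \<open>k = 0\<close> there is exactly the empty tuple, with sum \<open>0\<close>.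
\<close>

definition compositions :: "nat \<Rightarrow> nat \<Rightarrow> (nat \<Rightarrow> nat) set" where
  "compositions k n = {p \<in> {1..k} \<rightarrow>\<^sub>E {1..}. (\<Sum>i=1..k. p i) = n}"

lemma finite_compositions: "finite (compositions k n)"
proof (rule finite_subset)
  show "compositions k n \<subseteq> {1..k} \<rightarrow>\<^sub>E {..n}"
  proof
    fix p assume p: "p \<in> compositions k n"
    have "p i \<le> n" if "i \<in> {1..k}" for i
      using p member_le_sum[OF that, of p] by (auto simp: compositions_def)
    then show "p \<in> {1..k} \<rightarrow>\<^sub>E {..n}"
      using p by (auto simp: compositions_def PiE_iff)
  qed
qed (simp add: finite_PiE)

lemma compositions_0: "compositions 0 n = (if n = 0 then {\<lambda>_. undefined} else {})"
  by (auto simp: compositions_def)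

definition multinomial :: "nat \<Rightarrow> nat \<Rightarrow> (nat \<Rightarrow> nat) \<Rightarrow> real" where
  "multinomial n k p = fact n / (\<Prod>i=1..k. fact (p i))"

end

theory Submission
  imports Defs
begin

text \<open>
  With \<open>F(s)\<close> the formal exponential generating function of the moments of \<open>Y\<close>, the Bell polynomials
  have the exponential generating function \<open>exp (y (F(s) - 1))\<close>. Evaluating it at \<open>s + t\<close> and
  factoring as \<open>exp (y (F(s) - 1)) exp (y (F(s + t) - F(s)))\<close> gives the theorem on comparing
  coefficients of \<open>s\<^sup>l t\<^sup>n\<close>: since \<open>F(s + t) - F(s)\<close> is the formal expectation of
  \<open>exp (s Y) (exp (t Y) - 1)\<close>, the coefficients of its \<open>k\<close>-th power are the sums over
  compositions of the mixed moments of \<open>S\<^sub>k\<close> and \<open>Y\<^sub>1, \<dots>, Y\<^sub>k\<close>. The integrability of exponentials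
  is only used to get all moments; the generating functions are formal power series.
\<close>

section \<open>Formal Taylor expansion of power series\<close>

unbundle no vec_syntax
unbundle fps_syntax

text \<open>The equation determines each coefficient from the earlier ones, after cancelling
  \<open>Suc m\<close>. Coefficients from an integral domain are allowed so that they can be power
  series themselves.\<close>

lemma fps_linear_ode_unique:
  fixes A B C :: "'a :: {idom, semiring_char_0} fps"
  assumes "fps_deriv A = C * A" "fps_deriv B = C * B" "A $ 0 = B $ 0"
  shows "A = B"
proof -
  have "A $ n = B $ n" for n
  proof (induction n rule: less_induct)
    case (less n)
    show ?case
    proof (cases n)
      case (Suc m)
      have "of_nat (Suc m) * A $ Suc m = (C * A) $ m"
        using fps_deriv_nth[of A m] by (simp add: assms)
      also have "\<dots> = (C * B) $ m"
        unfolding fps_mult_nth using Suc by (intro sum.cong refl) (simp add: less)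
      also have "\<dots> = of_nat (Suc m) * B $ Suc m"
        using fps_deriv_nth[of B m] by (simp add: assms)
      finally show ?thesis
        unfolding Suc by (metis mult_cancel_left of_nat_neq_0)
    qed (simp add: assms)
  qed
  then show ?thesis by (simp add: fps_eq_iff)
qed

text \<open>The expansion \<open>f (s + t)\<close> as a power series in \<open>t\<close> whose coefficients are power series in \<open>s\<close>.\<close>

definition fps_taylor :: "'a :: semiring_1 fps \<Rightarrow> 'a fps fps" where
  "fps_taylor f = Abs_fps (\<lambda>n. Abs_fps (\<lambda>j. of_nat ((n + j) choose n) * f $ (n + j)))"

lemma fps_taylor_nth: "fps_taylor f $ n $ j = of_nat ((n + j) choose n) * f $ (n + j)"
  by (simp add: fps_taylor_def)

lemma fps_taylor_nth_0: "fps_taylor f $ 0 = f"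
  by (simp add: fps_eq_iff fps_taylor_nth)

lemma fps_taylor_add: "fps_taylor (f + g) = fps_taylor f + fps_taylor g"
  by (simp add: fps_eq_iff fps_taylor_nth algebra_simps)

lemma fps_taylor_const: "fps_taylor (fps_const c) = fps_const (fps_const c)"
  by (auto simp: fps_eq_iff fps_taylor_nth)

lemma fps_taylor_diff: "fps_taylor (f - g) = fps_taylor f - fps_taylor (g :: 'a :: ring_1 fps)"
  by (simp add: fps_eq_iff fps_taylor_nth algebra_simps)

text \<open>The chain rule in t; on coefficients it is the absorption identity for binomial
  coefficients.\<close>

lemma fps_deriv_taylor:
  "fps_deriv (fps_taylor f) = fps_taylor (fps_deriv (f :: 'a :: comm_semiring_1 fps))"
proof -
  have "of_nat (Suc n) * (of_nat (Suc (n + j) choose Suc n) * f $ Suc (n + j)) =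
        of_nat ((n + j) choose n) * (of_nat (Suc (n + j)) * f $ Suc (n + j))" for n j
    by (simp only: mult.assoc[symmetric] of_nat_mult[symmetric] Suc_times_binomial mult.commute)
  then show ?thesis
    by (simp add: fps_eq_iff fps_taylor_nth fps_mult_of_nat_nth del: of_nat_Suc binomial_Suc_Suc)
qed

text \<open>By the Leibniz rule, coefficient n + 1 in t reduces to coefficient n for the pairs (f',
  g) and (f, g'); hence the induction varies \<open>f\<close> and \<open>g\<close>.\<close>

lemma fps_taylor_mult:
  fixes f g :: "'a :: {idom, semiring_char_0} fps"
  shows "fps_taylor (f * g) = fps_taylor f * fps_taylor g"
proof -
  have "fps_taylor (f * g) $ n = (fps_taylor f * fps_taylor g) $ n" for n
  proof (induction n arbitrary: f g)
    case 0
    show ?case by (simp add: fps_taylor_nth_0)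
  next
    case (Suc n)
    have "of_nat (Suc n) * fps_taylor (f * g) $ Suc n = fps_deriv (fps_taylor (f * g)) $ n"
      by simp
    also have "\<dots> = fps_deriv (fps_taylor f * fps_taylor g) $ n"
      using Suc by (simp only: fps_deriv_taylor fps_deriv_mult fps_taylor_add fps_add_nth)
    also have "\<dots> = of_nat (Suc n) * (fps_taylor f * fps_taylor g) $ Suc n"
      by (simp del: fps_deriv_mult)
    finally show ?case
      by (metis mult_cancel_left of_nat_neq_0)
  qed
  then show ?thesis by (simp add: fps_eq_iff)
qed

text \<open>This is \<open>exp (c f(s + t)) = exp (c f(s)) exp (c (f(s + t) - f(s)))\<close>; both sides solve
  the same linear differential equation in \<open>t\<close>.\<close>

lemma fps_taylor_exp_compose:
  fixes f :: "'a :: field_char_0 fps"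
  assumes "f $ 0 = 0"
  shows "fps_taylor (fps_exp c oo f) = fps_const (fps_exp c oo f) *
    (Abs_fps (\<lambda>k. fps_const (c ^ k / fact k)) oo (fps_taylor f - fps_const f))"
proof -
  define G where "G = fps_exp c oo f"
  define H where "H = fps_taylor f - fps_const f"
  \<comment> \<open>This is exp (c x) over the ring of power series in s, which is not a field: the
    scalars c^k / k! are embedded as constants.\<close>
  define E where "E = Abs_fps (\<lambda>k. fps_const (c ^ k / fact k :: 'a))"
  have H0: "H $ 0 = 0"
    by (simp add: H_def fps_taylor_nth_0)
  have derivE: "fps_deriv E = fps_const (fps_const c) * E"
    by (simp add: fps_eq_iff E_def fps_mult_of_nat_nth field_simps del: of_nat_Suc)
  have derivG: "fps_deriv G = fps_const c * (fps_deriv f * G)"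
    by (simp add: G_def fps_compose_deriv assms mult_ac flip: fps_const_mult_apply_left)
  have "fps_taylor G = fps_const G * (E oo H)"
  proof (rule fps_linear_ode_unique)
    show "fps_deriv (fps_taylor G) = (fps_const (fps_const c) * fps_deriv (fps_taylor f)) * fps_taylor G"
      by (simp add: fps_deriv_taylor derivG fps_taylor_const fps_taylor_mult mult_ac)
    \<comment> \<open>In t, \<open>fps_const G\<close> and \<open>fps_const f\<close> are constants,
      so \<open>H\<close> and \<open>fps_taylor f\<close> have the same derivative.\<close>
    show "fps_deriv (fps_const G * (E oo H)) =
      (fps_const (fps_const c) * fps_deriv (fps_taylor f)) * (fps_const G * (E oo H))"
      by (simp add: fps_compose_deriv H0 derivE fps_const_mult_apply_left[symmetric])
        (simp add: H_def mult_ac)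
    show "fps_taylor G $ 0 = (fps_const G * (E oo H)) $ 0"
      by (simp add: fps_taylor_nth_0 E_def)
  qed
  then show ?thesis by (simp add: G_def H_def E_def)
qed

section \<open>Compositions and powers of series\<close>

lemma sum_compositions_Suc:
  fixes h :: "nat \<Rightarrow> 'a :: comm_semiring_1"
  shows "(\<Sum>p\<in>compositions (Suc k) n. \<Prod>i=1..Suc k. h (p i)) =
    (\<Sum>j=1..n. h j * (\<Sum>p\<in>compositions k (n - j). \<Prod>i=1..k. h (p i)))"
proof -
  have prod_upd: "(\<Prod>i=1..k. h ((p(Suc k := j)) i)) = (\<Prod>i=1..k. h (p i))" for p j
    by (intro prod.cong) auto
  have sum_upd: "(\<Sum>i=1..k. (p(Suc k := j)) i) = (\<Sum>i=1..k. p i)" for p :: "nat \<Rightarrow> nat" and j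
    by (intro sum.cong) auto
  have "(\<Sum>j=1..n. h j * (\<Sum>p\<in>compositions k (n - j). \<Prod>i=1..k. h (p i))) =
    (\<Sum>(j, p)\<in>Sigma {1..n} (\<lambda>j. compositions k (n - j)). h j * (\<Prod>i=1..k. h (p i)))"
    by (simp add: sum_distrib_left sum.Sigma finite_compositions)
  also have "\<dots> = (\<Sum>p\<in>compositions (Suc k) n. \<Prod>i=1..Suc k. h (p i))"
  \<comment> \<open>Splits off the last part. Its entry is reset to \<open>undefined\<close> because
    shorter tuples must be extensional on \<open>{1..k}\<close>.\<close>
  proof (rule sum.reindex_bij_witness[where i = "\<lambda>p. (p (Suc k), p(Suc k := undefined))"
        and j = "\<lambda>(j, p). p(Suc k := j)"], goal_cases)
    case (1 a)
    then show ?case by (auto simp: compositions_def PiE_iff extensional_def fun_eq_iff)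
  next
    case (2 a)
    then show ?case
      using sum_upd[of "snd a" "fst a"]
      by (auto simp: compositions_def PiE_iff extensional_def simp del: fun_upd_apply)
        (auto simp: le_Suc_eq)
  next
    case (3 p)
    then show ?case by simp
  next
    case (4 p)
    then show ?case
      using sum_upd[of p undefined]
      by (auto simp: compositions_def PiE_iff extensional_def simp del: fun_upd_apply)
        (auto simp: le_Suc_eq)
  next
    case (5 a)
    then show ?case
      using prod_upd[of "snd a" "fst a"] by (auto simp: mult_ac simp del: fun_upd_apply) simp
  qed
  finally show ?thesis by simp
qed

text \<open>Removing the constant coefficient is what restricts the parts to positive
  integers.\<close>

lemma fps_power_nth_compositions:
  fixes f :: "'a :: comm_ring_1 fps"
  shows "((f - fps_const (f $ 0)) ^ k) $ n = (\<Sum>p\<in>compositions k n. \<Prod>i=1..k. f $ p i)"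
proof (induction k arbitrary: n)
  case 0
  show ?case by (simp add: compositions_0)
next
  case (Suc k)
  have "((f - fps_const (f $ 0)) ^ Suc k) $ n =
    (\<Sum>j=0..n. (f - fps_const (f $ 0)) $ j * (\<Sum>p\<in>compositions k (n - j). \<Prod>i=1..k. f $ p i))"
    by (simp add: fps_mult_nth Suc)
  also have "\<dots> = (\<Sum>j=1..n. f $ j * (\<Sum>p\<in>compositions k (n - j). \<Prod>i=1..k. f $ p i))"
    by (simp add: sum.atLeast_Suc_atMost)
  finally show ?case by (simp only: sum_compositions_Suc)
qed

lemma fps_const_prod: "(\<Prod>i\<in>I. fps_const (c i)) = fps_const (\<Prod>i\<in>I. c i :: 'a :: comm_ring_1)"
  by (induction I rule: infinite_finite_induct) auto

section \<open>Existence of moments, and mixed moments of partial sums\<close>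

lemma power_div_fact_le_exp:
  fixes x :: real
  assumes "x \<ge> 0"
  shows "x ^ n / fact n \<le> exp x"
proof -
  have "(\<Sum>i\<in>{n}. x ^ i / fact i) \<le> (\<Sum>i. x ^ i / fact i)"
    using assms summable_exp[of x] by (intro sum_le_suminf) (auto simp: field_simps)
  then show ?thesis
    by (simp add: exp_def divide_inverse mult.commute)
qed

lemma integrable_power_of_exp:
  fixes Y :: "'a \<Rightarrow> real"
  assumes [measurable]: "Y \<in> borel_measurable N"
    and "t > 0" "integrable N (\<lambda>\<omega>. exp (t * Y \<omega>))" "integrable N (\<lambda>\<omega>. exp (- t * Y \<omega>))"
  shows "integrable N (\<lambda>\<omega>. Y \<omega> ^ n)"
proof (rule Bochner_Integration.integrable_bound)
  show "integrable N (\<lambda>\<omega>. fact n / t ^ n * (exp (t * Y \<omega>) + exp (- t * Y \<omega>)))"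
    using assms by (intro Bochner_Integration.integrable_add integrable_mult_right) auto
  \<comment> \<open>One term of the series of exp (t |x|) is at most its sum, and exp (t |x|) is one
    of the two exponentials on the right.\<close>
  have "\<bar>x\<bar> ^ n \<le> fact n / t ^ n * (exp (t * x) + exp (- t * x))" for x
  proof -
    have "(t * \<bar>x\<bar>) ^ n / fact n \<le> exp (t * \<bar>x\<bar>)"
      using \<open>t > 0\<close> by (intro power_div_fact_le_exp) auto
    also have "\<dots> \<le> exp (t * x) + exp (- t * x)"
      by (cases "x \<ge> 0") auto
    finally show ?thesis
      using \<open>t > 0\<close> by (simp add: field_simps power_mult_distrib)
  qed
  with \<open>t > 0\<close> show "AE \<omega> in N. norm (Y \<omega> ^ n) \<le>
      norm (fact n / t ^ n * (exp (t * Y \<omega>) + exp (- t * Y \<omega>)))"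
    by (intro AE_I2) (simp add: power_abs order_trans[OF _ abs_ge_self])
qed simp

text \<open>By independence every monomial factorises; expanding only the first \<open>r\<close> summands is what
  lets the induction absorb the powers of each further summand into the exponents \<open>p\<close>.\<close>

lemma (in prob_space) expectation_partial_sum_power_prod_aux:
  fixes X :: "nat \<Rightarrow> 'a \<Rightarrow> real" and \<mu> :: "nat \<Rightarrow> real"
  assumes indep: "indep_vars (\<lambda>_. borel) X {1..}"
    and int: "\<And>i n. i \<ge> 1 \<Longrightarrow> integrable M (\<lambda>\<omega>. X i \<omega> ^ n)"
    and moment: "\<And>i n. i \<ge> 1 \<Longrightarrow> expectation (\<lambda>\<omega>. X i \<omega> ^ n) = \<mu> n"
    and "r \<le> k"
  shows "integrable M (\<lambda>\<omega>. partial_sum X r \<omega> ^ j * (\<Prod>i=1..k. X i \<omega> ^ p i)) \<and>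
    expectation (\<lambda>\<omega>. partial_sum X r \<omega> ^ j * (\<Prod>i=1..k. X i \<omega> ^ p i)) =
      fact j * (\<Prod>i=1..k. if i \<le> r then Abs_fps (\<lambda>j. \<mu> (p i + j) / fact j)
        else fps_const (\<mu> (p i))) $ j"
  using \<open>r \<le> k\<close>
proof (induction r arbitrary: j p)
  case 0
  have indep_pow: "indep_vars (\<lambda>_. borel) (\<lambda>i \<omega>. X i \<omega> ^ p i) {1..k}"
    by (rule indep_vars_compose2[OF indep_vars_subset[OF indep]]) auto
  have "integrable M (\<lambda>\<omega>. \<Prod>i=1..k. X i \<omega> ^ p i)"
    by (rule indep_vars_integrable[OF _ indep_pow]) (auto intro: int)
  moreover have "expectation (\<lambda>\<omega>. \<Prod>i=1..k. X i \<omega> ^ p i) = (\<Prod>i=1..k. \<mu> (p i))"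
    by (subst indep_vars_lebesgue_integral[OF _ indep_pow]) (auto intro: int simp: moment)
  moreover have "(\<Prod>i=1..k. if i \<le> 0 then Abs_fps (\<lambda>j. \<mu> (p i + j) / fact j)
      else fps_const (\<mu> (p i))) = fps_const (\<Prod>i=1..k. \<mu> (p i))"
    unfolding fps_const_prod[symmetric] by (intro prod.cong) auto
  \<comment> \<open>The empty partial sum contributes \<open>0 ^ j\<close>, which is 1 at
    \<open>j = 0\<close> and 0 otherwise, matching a constant series.\<close>
  ultimately show ?case
    by (cases j) (simp_all add: partial_sum_def)
next
  case (Suc r)
  define D where "D = (\<lambda>r (p :: nat \<Rightarrow> nat) i.
    if i \<le> r then Abs_fps (\<lambda>j. \<mu> (p i + j) / fact j) else fps_const (\<mu> (p i)))"
  \<comment> \<open>In the binomial expansion of the partial sum, the term with index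
    \<open>a\<close> carries \<open>j - a\<close> further factors \<open>X (Suc r)\<close>;
    \<open>q a\<close> records them in the exponents.\<close>
  define q where "q = (\<lambda>a. p(Suc r := p (Suc r) + (j - a)))"
  define Q where "Q = (\<Prod>i\<in>{1..k} - {Suc r}. D r p i)"
  define T where "T = (\<lambda>a \<omega>. partial_sum X r \<omega> ^ a * (\<Prod>i=1..k. X i \<omega> ^ q a i))"
  have mem: "Suc r \<in> {1..k}"
    using Suc.prems by auto
  have intT: "integrable M (T a)"
    and expT: "expectation (T a) = fact a * (\<Prod>i=1..k. D r (q a) i) $ a" for a
    using Suc.IH[of a "q a"] Suc.prems by (simp_all add: T_def D_def)
  have expand: "partial_sum X (Suc r) \<omega> ^ j * (\<Prod>i=1..k. X i \<omega> ^ p i) =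
      (\<Sum>a\<le>j. real (j choose a) * T a \<omega>)" for \<omega>
  proof -
    have "(\<Prod>i=1..k. X i \<omega> ^ q a i) = X (Suc r) \<omega> ^ (j - a) * (\<Prod>i=1..k. X i \<omega> ^ p i)" for a
    proof -
      have "(\<Prod>i\<in>{1..k} - {Suc r}. X i \<omega> ^ q a i) = (\<Prod>i\<in>{1..k} - {Suc r}. X i \<omega> ^ p i)"
        by (intro prod.cong) (auto simp: q_def)
      then show ?thesis
        by (simp only: prod.remove[OF finite_atLeastAtMost mem]) (simp add: q_def power_add)
    qed
    then show ?thesis
      by (simp add: T_def partial_sum_def binomial_ring sum_distrib_left mult_ac)
  qed
  have prod_q: "(\<Prod>i=1..k. D r (q a) i) = fps_const (\<mu> (p (Suc r) + (j - a))) * Q" for a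
  proof -
    have "(\<Prod>i\<in>{1..k} - {Suc r}. D r (q a) i) = Q"
      unfolding Q_def by (intro prod.cong) (auto simp: q_def D_def)
    then show ?thesis
      by (simp only: prod.remove[OF finite_atLeastAtMost mem]) (simp add: D_def q_def)
  qed
  have "(\<Prod>i\<in>{1..k} - {Suc r}. D (Suc r) p i) = Q"
    unfolding Q_def by (intro prod.cong) (auto simp: D_def)
  then have prod_Suc: "(\<Prod>i=1..k. D (Suc r) p i) =
      Q * Abs_fps (\<lambda>j. \<mu> (p (Suc r) + j) / fact j)"
    by (simp only: prod.remove[OF finite_atLeastAtMost mem]) (simp add: D_def mult.commute)
  have "expectation (\<lambda>\<omega>. \<Sum>a\<le>j. real (j choose a) * T a \<omega>) =
      (\<Sum>a\<le>j. real (j choose a) * expectation (T a))"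
    by (simp add: intT)
  \<comment> \<open>Since (j choose a) a! = j! / (j - a)!, the sum is a Cauchy product with the new
    factor.\<close>
  also have "\<dots> = fact j * (\<Prod>i=1..k. D (Suc r) p i) $ j"
    unfolding expT prod_q prod_Suc fps_mult_nth[of Q] sum_distrib_left atLeast0AtMost
    by (intro sum.cong refl) (simp add: binomial_fact)
  finally show ?case
    unfolding expand D_def by (intro conjI Bochner_Integration.integrable_sum integrable_mult_right intT)
qed

text \<open>Formally E[Y^a exp (s Y)] is the a-th derivative of F, that is a! times the coefficient
  of t^a in F(s + t); independence multiplies these factors.\<close>

lemma (in prob_space) expectation_partial_sum_power_prod:
  fixes X :: "nat \<Rightarrow> 'a \<Rightarrow> real" and \<mu> :: "nat \<Rightarrow> real"
  assumes "indep_vars (\<lambda>_. borel) X {1..}"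
    and "\<And>i n. i \<ge> 1 \<Longrightarrow> integrable M (\<lambda>\<omega>. X i \<omega> ^ n)"
    and "\<And>i n. i \<ge> 1 \<Longrightarrow> expectation (\<lambda>\<omega>. X i \<omega> ^ n) = \<mu> n"
  shows "expectation (\<lambda>\<omega>. partial_sum X k \<omega> ^ j * (\<Prod>i=1..k. X i \<omega> ^ p i)) =
    fact j * (\<Prod>i=1..k. fact (p i)) *
      (\<Prod>i=1..k. fps_taylor (Abs_fps (\<lambda>j. \<mu> j / fact j)) $ p i) $ j"
proof -
  have "Abs_fps (\<lambda>j. \<mu> (a + j) / fact j) =
      fps_const (fact a) * fps_taylor (Abs_fps (\<lambda>j. \<mu> j / fact j)) $ a" for a
    by (simp add: fps_eq_iff fps_taylor_nth binomial_fact)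
  then have "(\<Prod>i=1..k. if i \<le> k then Abs_fps (\<lambda>j. \<mu> (p i + j) / fact j)
        else fps_const (\<mu> (p i))) =
      fps_const (\<Prod>i=1..k. fact (p i)) *
        (\<Prod>i=1..k. fps_taylor (Abs_fps (\<lambda>j. \<mu> j / fact j)) $ p i)"
    by (simp add: prod.distrib flip: fps_const_prod)
  then show ?thesis
    using expectation_partial_sum_power_prod_aux[OF assms, of k k j p] by simp
qed

section \<open>Generating function of the Bell polynomials\<close>

lemma (in prob_space) prob_bell_eq_fps_nth:
  fixes X :: "nat \<Rightarrow> 'a \<Rightarrow> real" and \<mu> :: "nat \<Rightarrow> real"
  assumes "indep_vars (\<lambda>_. borel) X {1..}"
    and "\<And>i n. i \<ge> 1 \<Longrightarrow> integrable M (\<lambda>\<omega>. X i \<omega> ^ n)"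
    and "\<And>i n. i \<ge> 1 \<Longrightarrow> expectation (\<lambda>\<omega>. X i \<omega> ^ n) = \<mu> n"
  shows "prob_bell M X n y = fact n * (fps_exp y oo (Abs_fps (\<lambda>j. \<mu> j / fact j) - 1)) $ n"
proof -
  define F where "F = Abs_fps (\<lambda>j. \<mu> j / fact j)"
  have moment: "expectation (\<lambda>\<omega>. partial_sum X l \<omega> ^ n) = fact n * (F ^ l) $ n" for l
    using expectation_partial_sum_power_prod[OF assms, of l n "\<lambda>_. 0"]
    by (simp add: F_def fps_taylor_nth_0)
  have "prob_stirling M X n k = fact n / fact k * ((F - 1) ^ k) $ n" for k
  proof -
    \<comment> \<open>The alternating sum in \<open>prob_stirling\<close> is this binomial
      expansion, read off at coefficient \<open>n\<close>.\<close>
    have "(F - 1) ^ k = (\<Sum>l\<le>k. fps_const (real (k choose l) * (-1) ^ (k - l)) * F ^ l)"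
      using binomial_ring[of F "-1" k]
      by (simp add: fps_of_nat[symmetric] fps_const_power[symmetric] mult_ac
          flip: fps_const_mult fps_const_neg)
    then have "((F - 1) ^ k) $ n = (\<Sum>l\<le>k. real (k choose l) * (-1) ^ (k - l) * (F ^ l) $ n)"
      by (simp add: fps_sum_nth)
    then show ?thesis
      by (simp add: prob_stirling_def moment sum_distrib_left atLeast0AtMost mult_ac)
  qed
  then show ?thesis
    by (simp add: prob_bell_def fps_compose_nth sum_distrib_left mult_ac flip: F_def)
qed

section \<open>The recurrence, by comparing coefficients\<close>

theorem theorem2p6:
  fixes N :: "'b measure" and Y :: "'b \<Rightarrow> real"
    and M :: "'a measure" and Ys :: "nat \<Rightarrow> 'a \<Rightarrow> real"
    and \<delta> y :: real and n l :: nat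
  assumes "prob_space N"
    and "Y \<in> borel_measurable N"
    and "\<delta> > 0"
    and "\<And>t. \<bar>t\<bar> < \<delta> \<Longrightarrow> integrable N (\<lambda>\<omega>. exp (t * Y \<omega>))"
    and "prob_space M"
    and "prob_space.indep_vars M (\<lambda>_. borel) Ys {1..}"
    and "\<And>j. j \<ge> 1 \<Longrightarrow> distr M borel (Ys j) = distr N borel Y"
  shows "prob_bell M Ys (l + n) y =
    (\<Sum>k=0..n. \<Sum>m=0..l. real (l choose m) * (y ^ k / fact k) *
      (\<Sum>p\<in>compositions k n. multinomial n k p *
        prob_space.expectation M
          (\<lambda>\<omega>. partial_sum Ys k \<omega> ^ (l - m) * (\<Prod>i=1..k. Ys i \<omega> ^ p i))) *
      prob_bell M Ys m y)"
proof -
  interpret N: prob_space N by fact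
  interpret M: prob_space M by fact
  note [measurable] = assms(2)
  define \<mu> where "\<mu> = (\<lambda>n. N.expectation (\<lambda>\<omega>. Y \<omega> ^ n))"
  define F where "F = Abs_fps (\<lambda>j. \<mu> j / fact j)"
  define G where "G = fps_exp y oo (F - 1)"
  define H where "H = fps_taylor F - fps_const F"
  have meas [measurable]: "Ys i \<in> borel_measurable M" if "i \<ge> 1" for i
    using assms(6) that by (auto simp: M.indep_vars_def)
  \<comment> \<open>Both \<open>\<delta> / 2\<close> and its negative lie in the interval where the
    exponential moments exist.\<close>
  have intY: "integrable N (\<lambda>\<omega>. Y \<omega> ^ n)" for n
    using assms(3) assms(4)[of "\<delta> / 2"] assms(4)[of "- (\<delta> / 2)"]
    by (intro integrable_power_of_exp[where t = "\<delta> / 2"]) auto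
  have int: "integrable M (\<lambda>\<omega>. Ys i \<omega> ^ n)" if "i \<ge> 1" for i n
    using intY[of n] that integrable_distr_eq[OF meas[OF that], of "\<lambda>x. x ^ n"]
      integrable_distr_eq[OF assms(2), of "\<lambda>x. x ^ n"] by (simp add: assms(7))
  have moment: "M.expectation (\<lambda>\<omega>. Ys i \<omega> ^ n) = \<mu> n" if "i \<ge> 1" for i n
    using that integral_distr[OF meas[OF that], of "\<lambda>x. x ^ n"]
      integral_distr[OF assms(2), of "\<lambda>x. x ^ n"] by (simp add: assms(7) \<mu>_def)
  have expectation: "M.expectation (\<lambda>\<omega>. partial_sum Ys k \<omega> ^ j * (\<Prod>i=1..k. Ys i \<omega> ^ p i)) =
      fact j * (\<Prod>i=1..k. fact (p i)) * (\<Prod>i=1..k. fps_taylor F $ p i) $ j" for k j p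
    unfolding F_def by (rule M.expectation_partial_sum_power_prod[OF assms(6) int moment])
  have bell: "prob_bell M Ys j y = fact j * G $ j" for j
    unfolding G_def F_def by (rule M.prob_bell_eq_fps_nth[OF assms(6) int moment])
  have H_eq: "fps_taylor (F - 1) - fps_const (F - 1) = H"
    using fps_taylor_const[of "1 :: real"]
    by (simp add: H_def fps_taylor_diff del: fps_const_sub flip: fps_const_sub)
  \<comment> \<open>The moment of order 0 is 1 because \<open>N\<close> has total mass 1.\<close>
  have "(F - 1) $ 0 = 0"
    by (simp add: F_def \<mu>_def N.prob_space)
  then have taylorG: "fps_taylor G =
      fps_const G * (Abs_fps (\<lambda>k. fps_const (y ^ k / fact k)) oo H)"
    using fps_taylor_exp_compose[of "F - 1" y] by (simp only: G_def H_eq)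
  \<comment> \<open>The factorials \<open>fact (p i)\<close> from the mixed moments cancel the
    denominators of the multinomial coefficient.\<close>
  have inner: "(\<Sum>p\<in>compositions k n. multinomial n k p *
        M.expectation (\<lambda>\<omega>. partial_sum Ys k \<omega> ^ j * (\<Prod>i=1..k. Ys i \<omega> ^ p i))) =
      fact n * fact j * (H ^ k) $ n $ j" for k j
    using fps_power_nth_compositions[of "fps_taylor F" k n]
    unfolding expectation multinomial_def
    by (simp add: H_def fps_taylor_nth_0 fps_sum_nth sum_distrib_left mult_ac)
  have "prob_bell M Ys (l + n) y = fact n * fact l * fps_taylor G $ n $ l"
    by (simp add: bell fps_taylor_nth binomial_fact add.commute)
  also have "\<dots> = (\<Sum>k=0..n. \<Sum>m=0..l.
      fact n * fact l * (G $ m * (y ^ k / fact k * (H ^ k) $ n $ (l - m))))"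
    by (simp add: taylorG fps_compose_nth fps_sum_nth fps_mult_nth[of G] sum_distrib_left
        sum.swap[of _ "{0..l}"])
  \<comment> \<open>Here l! = (l choose m) m! (l - m)!: the factor m! turns \<open>G $ m\<close>
    into a Bell polynomial, and n! (l - m)! goes to the sum over compositions.\<close>
  also have "\<dots> = (\<Sum>k=0..n. \<Sum>m=0..l. real (l choose m) * (y ^ k / fact k) *
      (fact n * fact (l - m) * (H ^ k) $ n $ (l - m)) * prob_bell M Ys m y)"
    by (intro sum.cong refl) (simp add: bell binomial_fact)
  finally show ?thesis
    by (simp only: inner)
qed

end
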